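(* Let $\Lambda$ be a quadratic Poisson tensor of $\mathbb{R}^n$. Suppose that its stabilizer $\mathfrak{g}_\Lambda$ contains $n$ mutually commuting linear vector fields $Y_1,\ldots,Y_n$ such that $Y_1\wedge\cdots\wedge Y_n\neq 0$ (i.e. this $n$-vector field is not identically zero). Then $\Lambda$ is implemented by a classical $r$-matrix that belongs to the stabilizer, i.e. there is $a\in\mathfrak{g}_\Lambda\wedge\mathfrak{g}_\Lambda$ with $[a,a]_{\mathrm{SN}}=0$ and $\Lambda=J^2a$.
   Context: A quadratic Poisson tensor of $\mathbb{R}^n$ is a bivector field $\Lambda=\sum_{i<j}\Lambda^{ij}\,\partial_i\wedge\partial_j$ with $\Lambda^{ij}$ homogeneous quadratic polynomials (possibly zero) and $[\Lambda,\Lambda]_{\mathrm{SN}}=0$, where $[\cdot,\cdot]_{\mathrm{SN}}$ is the Schouten-Nijenhuis bracket. Let $\mathfrak{g}=\mathfrak{gl}(n,\mathbb{R})$ and let $J^1$ be the Lie algebra isomorphism from $\mathfrak{g}$ onto the Lie algebra of linear vector fields of $\mathbb{R}^n$, $J^1(E_{ij})=x_i\partial_j$. It extends to a homomorphism of Grassmann algebras and of graded Poisson-Lie algebras $J$ from $\bigwedge\mathfrak{g}$ to polyvector fields; $J^k$ is its restriction $\bigwedge^k\mathfrak{g}\to \mathcal{S}^k\mathbb{R}^{n*}\otimes\bigwedge^k\mathbb{R}^n$, so $J^k(a_1\wedge\cdots\wedge a_k)=J^1a_1\wedge\cdots\wedge J^1a_k$. The bracket $[\cdot,\cdot]_{\mathrm{SN}}$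 on $\bigwedge\mathfrak{g}$ is the graded (algebraic Schouten) extension of the Lie bracket of $\mathfrak{g}$. A classical $r$-matrix is an element $r\in\mathfrak{g}\wedge\mathfrak{g}$ with $[r,r]_{\mathrm{SN}}=0$. The stabilizer of $\Lambda$ is $\mathfrak{g}_\Lambda=\{a\in\mathfrak{g}:[\Lambda,J^1a]_{\mathrm{SN}}=0\}$; it is identified via $J^1$ with the Lie algebra of linear vector fields $Y$ such that $[\Lambda,Y]_{\mathrm{SN}}=0$. *)

theory Defs
  imports "HOL-Analysis.Analysis"
begin

text \<open>
  The exterior algebra of a real vector space with basis \<open>(e\<^sub>i)\<close>, \<open>i :: 'i\<close>, is coordinatized by
  \<open>real ^ 'i set\<close>: the component at \<open>K\<close> is the coefficient of the monomial
  \<open>e\<^sub>K = e\<^bsub>k1\<^esub> \<and> \<dots> \<and> e\<^bsub>kp\<^esub>\<close>, where \<open>k1, \<dots>, kp\<close> lists \<open>K\<close> in increasing order. The order on \<open>'i\<close> is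
  the one induced by \<open>to_nat\<close>; it only serves to fix the signs of the monomials.
\<close>

type_synonym 'i ext = "real ^ 'i set"

definition shuffle_sign :: "'i::finite set \<Rightarrow> 'i set \<Rightarrow> real" where
  "shuffle_sign I J = (- 1) ^ card {(i, j) \<in> I \<times> J. to_nat j < to_nat i}"

definition wedge :: "'i::finite ext \<Rightarrow> 'i ext \<Rightarrow> 'i ext" (infixl "\<and>\<^sub>e" 70) where
  "P \<and>\<^sub>e Q = (\<chi> K. \<Sum>I\<in>Pow K. shuffle_sign I (K - I) * P $ I * Q $ (K - I))"

definition ext_gen :: "'i::finite \<Rightarrow> 'i ext" where
  "ext_gen i = axis {i} 1"

definition wedge_list :: "'i::finite ext list \<Rightarrow> 'i ext" where
  "wedge_list Ps = foldr (\<and>\<^sub>e) Ps (axis {} 1)"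

definition is_multivector :: "nat \<Rightarrow> 'i::finite ext \<Rightarrow> bool" where
  "is_multivector p P \<longleftrightarrow> (\<forall>K. card K \<noteq> p \<longrightarrow> P $ K = 0)"

text \<open>
  The left and right odd derivatives with respect to the generator \<open>e\<^sub>i\<close>: on monomials not
  containing \<open>e\<^sub>i\<close> they vanish, and they send \<open>e\<^sub>i \<and> e\<^sub>K\<close>, respectively \<open>e\<^sub>K \<and> e\<^sub>i\<close>, to \<open>e\<^sub>K\<close>.
\<close>

definition left_deriv :: "'i::finite \<Rightarrow> 'i ext \<Rightarrow> 'i ext" where
  "left_deriv i P = (\<chi> K. if i \<in> K then 0 else shuffle_sign {i} K * P $ insert i K)"

definition right_deriv :: "'i::finite \<Rightarrow> 'i ext \<Rightarrow> 'i ext" where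
  "right_deriv i P = (\<chi> K. if i \<in> K then 0 else shuffle_sign K {i} * P $ insert i K)"

text \<open>Polyvector fields of \<open>\<real>\<^sup>n\<close>; the generator \<open>ext_gen i\<close> stands for \<open>\<partial>\<^sub>i\<close>.
  The partial derivative below is meaningful on differentiable fields only.\<close>

type_synonym 'n polyvector_field = "real ^ 'n \<Rightarrow> 'n ext"

definition pd :: "'n::finite \<Rightarrow> 'n polyvector_field \<Rightarrow> 'n polyvector_field" where
  "pd i P x = frechet_derivative P (at x) (axis i 1)"

text \<open>
  The Schouten-Nijenhuis bracket in coordinates: with \<open>\<xi>\<^sub>i = \<partial>\<^sub>i\<close> as odd variables it is
  \<open>\<Sum>\<^sub>i (P \<partial>/\<partial>\<xi>\<^sub>i) \<and> (\<partial>Q/\<partial>x\<^sub>i) - (\<partial>P/\<partial>x\<^sub>i) \<and> (\<partial>/\<partial>\<xi>\<^sub>i Q)\<close>, the derivative by \<open>\<xi>\<^sub>i\<close> acting on \<open>P\<close> from the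
  right and on \<open>Q\<close> from the left. On vector fields this is the Lie bracket, and it satisfies
  \<open>[P, Q \<and> R] = [P, Q] \<and> R + (-1)\<^bsup>(p-1)q\<^esup> Q \<and> [P, R]\<close>.
\<close>

definition sn_bracket :: "'n::finite polyvector_field \<Rightarrow> 'n polyvector_field \<Rightarrow> 'n polyvector_field" where
  "sn_bracket P Q x =
     (\<Sum>i\<in>UNIV. right_deriv i (P x) \<and>\<^sub>e pd i Q x - pd i P x \<and>\<^sub>e left_deriv i (Q x))"

definition homogeneous_quadratic :: "(real ^ 'n::finite \<Rightarrow> real) \<Rightarrow> bool" where
  "homogeneous_quadratic f \<longleftrightarrow>
     (\<exists>c. \<forall>x. f x = (\<Sum>i\<in>UNIV. \<Sum>j\<in>UNIV. c i j * x $ i * x $ j))"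

definition quadratic_poisson :: "'n::finite polyvector_field \<Rightarrow> bool" where
  "quadratic_poisson \<Lambda> \<longleftrightarrow>
     (\<forall>x. is_multivector 2 (\<Lambda> x)) \<and>
     (\<forall>K. homogeneous_quadratic (\<lambda>x. \<Lambda> x $ K)) \<and>
     (\<forall>x. sn_bracket \<Lambda> \<Lambda> x = 0)"

text \<open>
  The Lie algebra \<open>gl(n, \<real>)\<close> is \<open>real ^ 'n ^ 'n\<close> with the commutator; its exterior algebra is
  \<open>('n \<times> 'n) ext\<close>, the generator \<open>ext_gen (i, j)\<close> being the elementary matrix \<open>E\<^sub>i\<^sub>j\<close>.
\<close>

definition elem_mat :: "'n::finite \<Rightarrow> 'n \<Rightarrow> real ^ 'n ^ 'n" where
  "elem_mat i j = axis i (axis j 1)"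

definition mat_commutator :: "real ^ 'n::finite ^ 'n \<Rightarrow> real ^ 'n ^ 'n \<Rightarrow> real ^ 'n ^ 'n" where
  "mat_commutator A B = A ** B - B ** A"

definition gl_ext :: "real ^ 'n::finite ^ 'n \<Rightarrow> ('n \<times> 'n) ext" where
  "gl_ext A = (\<Sum>i\<in>UNIV. \<Sum>j\<in>UNIV. A $ i $ j *\<^sub>R ext_gen (i, j))"

text \<open>
  The algebraic Schouten bracket: the biderivation
  \<open>\<Sum>\<^sub>u\<^sub>,\<^sub>v (a \<partial>/\<partial>e\<^sub>u) \<and> [e\<^sub>u, e\<^sub>v] \<and> (\<partial>/\<partial>e\<^sub>v b)\<close>, which obeys the same graded Leibniz rule as
  \<open>sn_bracket\<close> and reduces to the commutator on \<open>gl(n, \<real>)\<close>.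
\<close>

definition gl_bracket :: "('n::finite \<times> 'n) ext \<Rightarrow> ('n \<times> 'n) ext \<Rightarrow> ('n \<times> 'n) ext" where
  "gl_bracket a b =
     (\<Sum>i\<in>UNIV. \<Sum>j\<in>UNIV. \<Sum>k\<in>UNIV. \<Sum>l\<in>UNIV.
        right_deriv (i, j) a \<and>\<^sub>e gl_ext (mat_commutator (elem_mat i j) (elem_mat k l))
          \<and>\<^sub>e left_deriv (k, l) b)"

definition classical_r_matrix :: "('n::finite \<times> 'n) ext \<Rightarrow> bool" where
  "classical_r_matrix r \<longleftrightarrow> is_multivector 2 r \<and> gl_bracket r r = 0"

definition J1 :: "real ^ 'n::finite ^ 'n \<Rightarrow> 'n polyvector_field" where
  "J1 A x = (\<Sum>i\<in>UNIV. \<Sum>j\<in>UNIV. (A $ i $ j * x $ i) *\<^sub>R ext_gen j)"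

definition increasing_list :: "'i::finite set \<Rightarrow> 'i list" where
  "increasing_list K = map from_nat (sorted_list_of_set (to_nat ` K))"

text \<open>The extension of \<open>J1\<close> to a homomorphism of Grassmann algebras, given on monomials.\<close>

definition J :: "('n::finite \<times> 'n) ext \<Rightarrow> 'n polyvector_field" where
  "J a x = (\<Sum>K\<in>UNIV. a $ K *\<^sub>R
     wedge_list (map (\<lambda>(i, j). J1 (elem_mat i j) x) (increasing_list K)))"

definition stabilizer :: "'n::finite polyvector_field \<Rightarrow> (real ^ 'n ^ 'n) set" where
  "stabilizer \<Lambda> = {A. \<forall>x. sn_bracket \<Lambda> (J1 A) x = 0}"

definition wedge_square :: "(real ^ 'n::finite ^ 'n) set \<Rightarrow> ('n \<times> 'n) ext set" where
  "wedge_square S = span {gl_ext A \<and>\<^sub>e gl_ext B | A B. A \<in> S \<and> B \<in> S}"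

end

theory Submission
  imports Defs
begin

text \<open>
  Pick \<open>x\<^sub>0\<close> at which the \<open>Y\<^sub>i\<close> are linearly independent, and constants \<open>c\<^sub>i\<^sub>j\<close> such that \<open>\<Lambda>\<close> and
  \<open>\<Sum> c\<^sub>i\<^sub>j Y\<^sub>i \<and> Y\<^sub>j\<close> agree at \<open>x\<^sub>0\<close>. Their difference is a quadratic field \<open>B(x, x)\<close>, with \<open>B\<close> symmetric
  and bilinear, and it is invariant under all \<open>Y\<^sub>k\<close>: \<open>2 B(x, Y\<^sub>k(x))\<close> is a linear function of
  \<open>B(x, x)\<close>. As \<open>B(x\<^sub>0, x\<^sub>0) = 0\<close> and the \<open>Y\<^sub>k(x\<^sub>0)\<close> span, \<open>B(x\<^sub>0, \<cdot>) = 0\<close>; polarizing the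
  invariance at \<open>x\<^sub>0\<close> then gives \<open>B = 0\<close>. The bivector \<open>\<Sum> c\<^sub>i\<^sub>j A\<^sub>i \<and> A\<^sub>j\<close> of the commuting matrices
  \<open>A\<^sub>i\<close> of the fields \<open>Y\<^sub>i\<close> is the required r-matrix.
\<close>

subsection \<open>Products of one-vectors\<close>

text \<open>As a product over \<open>K\<close>, the sign gains one factor for each inserted element;
  the later sign computations rest on this.\<close>

lemma shuffle_sign_singleton:
  fixes i :: "'i::finite"
  shows "shuffle_sign {i} K = (\<Prod>k\<in>K. if to_nat k < to_nat i then - 1 else 1)"
proof -
  have "{(a, b) \<in> {i} \<times> K. to_nat b < to_nat a} = Pair i ` {k \<in> K. to_nat k < to_nat i}"
    by auto
  then have "card {(a, b) \<in> {i} \<times> K. to_nat b < to_nat a} = card {k \<in> K. to_nat k < to_nat i}"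
    by (simp add: card_image inj_on_def)
  then show ?thesis
    by (simp add: shuffle_sign_def prod.If_cases Int_def)
qed

lemma shuffle_sign_singletons:
  "shuffle_sign {i} {j} = (if to_nat j < to_nat (i :: 'i::finite) then - 1 else 1)"
  by (simp add: shuffle_sign_singleton)

lemma shuffle_sign_insert:
  assumes "k \<notin> K"
  shows "shuffle_sign {i} (insert k K) = shuffle_sign {i} {k} * shuffle_sign {i :: 'i::finite} K"
  using assms by (simp add: shuffle_sign_singleton)

lemma shuffle_sign_swap:
  assumes "i \<noteq> j"
  shows "shuffle_sign {i} {j} = - shuffle_sign {j} {i :: 'i::finite}"
  using assms inj_to_nat[THEN injD, of i j]
  by (auto simp: shuffle_sign_singletons not_less_iff_gr_or_eq)

lemma shuffle_sign_square: "shuffle_sign I K * shuffle_sign I K = 1"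
  by (simp add: shuffle_sign_def flip: power_add)

lemma shuffle_sign_empty: "shuffle_sign I {} = 1" "shuffle_sign {} I = 1"
  by (simp_all add: shuffle_sign_def)

lemma bilinear_wedge: "bilinear ((\<and>\<^sub>e) :: 'i::finite ext \<Rightarrow> _)"
  unfolding bilinear_def
  by (auto intro!: linearI
      simp: wedge_def vec_eq_iff algebra_simps sum.distrib sum_distrib_left)

lemmas wedge_linear_simps =
  bilinear_ladd[OF bilinear_wedge] bilinear_radd[OF bilinear_wedge]
  bilinear_lmul[OF bilinear_wedge] bilinear_rmul[OF bilinear_wedge]
  bilinear_lsub[OF bilinear_wedge] bilinear_rsub[OF bilinear_wedge]
  bilinear_lneg[OF bilinear_wedge] bilinear_rneg[OF bilinear_wedge]
  bilinear_lzero[OF bilinear_wedge] bilinear_rzero[OF bilinear_wedge]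

lemma wedge_sum_left: "sum f A \<and>\<^sub>e P = (\<Sum>i\<in>A. f i \<and>\<^sub>e P)"
  by (induction A rule: infinite_finite_induct) (auto simp: wedge_linear_simps)

lemma wedge_sum_right: "P \<and>\<^sub>e sum f A = (\<Sum>i\<in>A. P \<and>\<^sub>e f i)"
  by (induction A rule: infinite_finite_induct) (auto simp: wedge_linear_simps)

lemma ext_gen_wedge_nth:
  "(ext_gen j \<and>\<^sub>e P) $ K = (if j \<in> K then shuffle_sign {j} (K - {j}) * P $ (K - {j}) else 0)"
proof -
  have "(ext_gen j \<and>\<^sub>e P) $ K =
      (\<Sum>I\<in>Pow K. if I = {j} then shuffle_sign {j} (K - {j}) * P $ (K - {j}) else 0)"
    unfolding wedge_def ext_gen_def vec_lambda_beta by (intro sum.cong) (auto simp: axis_def)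
  then show ?thesis by (simp add: sum.delta)
qed

lemma ext_gen_wedge_ext_gen:
  "ext_gen j \<and>\<^sub>e ext_gen k = (if j = k then 0 else shuffle_sign {j} {k} *\<^sub>R axis {j, k} 1)"
proof (rule vec_eq_iff[THEN iffD2], rule allI)
  fix K
  have "j \<in> K \<and> K - {j} = {k} \<longleftrightarrow> j \<noteq> k \<and> K = {j, k}" by blast
  moreover have "(ext_gen j \<and>\<^sub>e ext_gen k) $ K =
      (if j \<in> K \<and> K - {j} = {k} then shuffle_sign {j} {k} else 0)"
    by (simp add: ext_gen_wedge_nth) (simp add: ext_gen_def axis_def)
  ultimately show "(ext_gen j \<and>\<^sub>e ext_gen k) $ K =
      (if j = k then 0 else shuffle_sign {j} {k} *\<^sub>R axis {j, k} 1) $ K"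
    by (simp add: axis_def)
qed

lemma wedge_one: "P \<and>\<^sub>e axis {} 1 = P"
proof (rule vec_eq_iff[THEN iffD2], rule allI)
  fix K
  have "(P \<and>\<^sub>e axis {} 1) $ K = (\<Sum>I\<in>Pow K. if I = K then P $ K else 0)"
    unfolding wedge_def vec_lambda_beta
  proof (rule sum.cong[OF refl])
    fix I assume "I \<in> Pow K"
    then have "K - I = {} \<longleftrightarrow> I = K" by blast
    then show "shuffle_sign I (K - I) * P $ I * axis {} 1 $ (K - I) = (if I = K then P $ K else 0)"
      by (cases "I = K") (simp_all add: axis_def shuffle_sign_empty)
  qed
  also have "\<dots> = P $ K" by (subst sum.delta) simp_all
  finally show "(P \<and>\<^sub>e axis {} 1) $ K = P $ K" .
qed

lemma one_wedge: "axis {} 1 \<and>\<^sub>e P = P"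
proof (rule vec_eq_iff[THEN iffD2], rule allI)
  fix K
  have "(axis {} 1 \<and>\<^sub>e P) $ K = (\<Sum>I\<in>Pow K. if I = {} then P $ K else 0)"
    unfolding wedge_def vec_lambda_beta
    by (rule sum.cong[OF refl]) (simp add: axis_def shuffle_sign_empty)
  also have "\<dots> = P $ K" by (subst sum.delta) simp_all
  finally show "(axis {} 1 \<and>\<^sub>e P) $ K = P $ K" .
qed

lemma linear_left_deriv: "linear (left_deriv i)"
  by (rule linearI) (simp_all add: left_deriv_def vec_eq_iff distrib_left)

lemma linear_right_deriv: "linear (right_deriv i)"
  by (rule linearI) (simp_all add: right_deriv_def vec_eq_iff distrib_left)

text \<open>The graded Leibniz rule of an odd derivative: the minus sign is the cost of passing the
  odd generator \<open>ext_gen j\<close>.\<close>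

lemma left_deriv_ext_gen_wedge:
  "left_deriv i (ext_gen j \<and>\<^sub>e P) = (if i = j then P else 0) - ext_gen j \<and>\<^sub>e left_deriv i P"
proof (rule vec_eq_iff[THEN iffD2], rule allI)
  fix K
  consider "i = j" | "i \<noteq> j" "i \<in> K" | "i \<noteq> j" "i \<notin> K" "j \<notin> K" | "i \<noteq> j" "i \<notin> K" "j \<in> K"
    by blast
  then show "left_deriv i (ext_gen j \<and>\<^sub>e P) $ K =
      ((if i = j then P else 0) - ext_gen j \<and>\<^sub>e left_deriv i P) $ K"
  proof cases
    \<comment> \<open>The one case in which both generators really move. Both sides contain the
      signs of \<open>i\<close> and of \<open>j\<close> against \<open>K - {j}\<close>; the left one
      also has the signs of \<open>i\<close> and \<open>j\<close> against each other in both orders,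
      whose product is -1.\<close>
    case 4
    have "shuffle_sign {i} K = shuffle_sign {i} {j} * shuffle_sign {i} (K - {j})"
      using 4 shuffle_sign_insert[of j "K - {j}" i] by (simp add: insert_absorb)
    moreover have "shuffle_sign {j} (insert i K - {j}) =
        shuffle_sign {j} {i} * shuffle_sign {j} (K - {j})"
      using 4 shuffle_sign_insert[of i "K - {j}" j] by (simp add: insert_Diff_if)
    moreover have "shuffle_sign {i} {j} * shuffle_sign {j} {i} = - 1"
      using 4 shuffle_sign_square[of "{j}" "{i}"] by (simp add: shuffle_sign_swap[of i j])
    ultimately have "shuffle_sign {i} K * shuffle_sign {j} (insert i K - {j}) =
        - (shuffle_sign {i} (K - {j}) * shuffle_sign {j} (K - {j}))"
      by algebra
    then show ?thesis
      using 4 by (simp add: left_deriv_def ext_gen_wedge_nth insert_Diff_if flip: mult.assoc)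
  next
    case 1
    have "shuffle_sign {j} M * (shuffle_sign {j} M * t) = t" for M t
      using shuffle_sign_square[of "{j}" M] by (simp flip: mult.assoc)
    then show ?thesis
      using 1 by (cases "j \<in> K") (simp_all add: left_deriv_def ext_gen_wedge_nth insert_absorb)
  qed (simp_all add: left_deriv_def ext_gen_wedge_nth)
qed

text \<open>A right derivative removes the last factor for free, while removing the first one
  requires a swap, hence the minus sign. Below, right derivatives are computed only for one-vectors
  and products of two of them.\<close>

lemma right_deriv_ext_gen_wedge_ext_gen:
  "right_deriv i (ext_gen j \<and>\<^sub>e ext_gen k) =
     (if i = k then ext_gen j else 0) - (if i = j then ext_gen k else 0)"
proof (cases "j = k")
  case True
  then show ?thesis
    by (simp add: ext_gen_wedge_ext_gen linear_0[OF linear_right_deriv])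
next
  case False
  have *: "right_deriv i (axis {j, k} 1) =
      (if i = k then shuffle_sign {j} {k} *\<^sub>R ext_gen j else 0)
      + (if i = j then shuffle_sign {k} {j} *\<^sub>R ext_gen k else 0)"
  proof (rule vec_eq_iff[THEN iffD2], rule allI)
    fix K
    have ins: "insert i K = {j, k} \<longleftrightarrow> i = k \<and> K = {j} \<or> i = j \<and> K = {k}" if "i \<notin> K"
    proof -
      have "insert i K = {j, k} \<longleftrightarrow> i \<in> {j, k} \<and> K = {j, k} - {i}"
        using that by blast
      then show ?thesis using False by auto
    qed
    consider "i \<in> K" | "i \<notin> K" "i = k" | "i \<notin> K" "i = j" | "i \<notin> K" "i \<noteq> j" "i \<noteq> k"
      by blast
    then show "right_deriv i (axis {j, k} 1) $ K =
      ((if i = k then shuffle_sign {j} {k} *\<^sub>R ext_gen j else 0)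
      + (if i = j then shuffle_sign {k} {j} *\<^sub>R ext_gen k else 0)) $ K"
      using False ins by cases (auto simp: right_deriv_def axis_def ext_gen_def)
  qed
  have "right_deriv i (ext_gen j \<and>\<^sub>e ext_gen k) =
      shuffle_sign {j} {k} *\<^sub>R right_deriv i (axis {j, k} 1)"
    unfolding ext_gen_wedge_ext_gen if_not_P[OF False] linear_scale[OF linear_right_deriv] ..
  moreover have "shuffle_sign {j} {k} * shuffle_sign {k} {j} = - 1"
    using shuffle_sign_square[of "{k}" "{j}"] by (simp add: shuffle_sign_swap[OF False])
  ultimately show ?thesis
    unfolding * by (simp add: scaleR_add_right shuffle_sign_square)
qed

section \<open>Calculus of one-vectors\<close>

text \<open>Coefficients are given by a function, so that vectors of the space and matrices, whose
  entries are indexed by pairs, are covered alike.\<close>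

definition one_vector :: "('i \<Rightarrow> real) \<Rightarrow> 'i::finite ext" where
  "one_vector f = (\<Sum>i\<in>UNIV. f i *\<^sub>R ext_gen i)"

lemma one_vector_wedge_expand:
  "one_vector f \<and>\<^sub>e one_vector g = (\<Sum>i\<in>UNIV. \<Sum>j\<in>UNIV. (f i * g j) *\<^sub>R (ext_gen i \<and>\<^sub>e ext_gen j))"
  unfolding one_vector_def wedge_sum_left
  by (simp add: wedge_sum_right wedge_linear_simps mult.commute)

lemma one_vector_anticommute: "one_vector f \<and>\<^sub>e one_vector g = - (one_vector g \<and>\<^sub>e one_vector f)"
proof -
  have *: "ext_gen i \<and>\<^sub>e ext_gen j = - (ext_gen j \<and>\<^sub>e ext_gen i)" for i j :: 'a
  proof (cases "i = j")
    case False
    then show ?thesis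
      by (simp add: ext_gen_wedge_ext_gen shuffle_sign_swap[OF False] insert_commute[of i j])
  qed (simp add: ext_gen_wedge_ext_gen)
  have "one_vector f \<and>\<^sub>e one_vector g
      = (\<Sum>i\<in>UNIV. \<Sum>j\<in>UNIV. - ((g j * f i) *\<^sub>R (ext_gen j \<and>\<^sub>e ext_gen i)))"
    unfolding one_vector_wedge_expand
    by (intro sum.cong refl) (subst *, simp add: mult.commute)
  also have "\<dots> = - (one_vector g \<and>\<^sub>e one_vector f)"
    unfolding one_vector_wedge_expand by (subst sum.swap) (simp add: sum_negf)
  finally show ?thesis .
qed

lemma left_deriv_one_vector_wedge:
  "left_deriv i (one_vector f \<and>\<^sub>e P) = f i *\<^sub>R P - one_vector f \<and>\<^sub>e left_deriv i P"
proof -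
  have "left_deriv i (one_vector f \<and>\<^sub>e P) =
      (\<Sum>j\<in>UNIV. f j *\<^sub>R ((if i = j then P else 0) - ext_gen j \<and>\<^sub>e left_deriv i P))"
    by (simp add: one_vector_def wedge_sum_left wedge_linear_simps linear_sum[OF linear_left_deriv]
        linear_scale[OF linear_left_deriv] left_deriv_ext_gen_wedge)
  also have "\<dots> = (\<Sum>j\<in>UNIV. if i = j then f j *\<^sub>R P else 0) - one_vector f \<and>\<^sub>e left_deriv i P"
    unfolding one_vector_def wedge_sum_left wedge_linear_simps sum_subtractf[symmetric]
    by (intro sum.cong) (auto simp: algebra_simps)
  finally show ?thesis by (simp add: sum.delta)
qed

lemma left_deriv_one: "left_deriv i (axis {} 1) = 0"
  by (auto simp: left_deriv_def axis_def vec_eq_iff)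

lemma left_deriv_one_vector: "left_deriv i (one_vector f) = f i *\<^sub>R axis {} 1"
proof -
  show ?thesis
    using left_deriv_one_vector_wedge[of i f "axis {} 1"]
    by (simp add: wedge_one left_deriv_one wedge_linear_simps)
qed

lemma is_multivector_one_vector_wedge:
  assumes "is_multivector p P"
  shows "is_multivector (Suc p) (one_vector f \<and>\<^sub>e P)"
proof -
  have "(ext_gen i \<and>\<^sub>e P) $ K = 0" if "card K \<noteq> Suc p" for i K
  proof -
    have "card (K - {i}) \<noteq> p" if "i \<in> K"
      using that \<open>card K \<noteq> Suc p\<close> card_Suc_Diff1[of K i] by auto
    then show ?thesis using assms by (auto simp: ext_gen_wedge_nth is_multivector_def)
  qed
  then show ?thesis
    by (auto simp: is_multivector_def one_vector_def wedge_sum_left wedge_linear_simps)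
qed

lemma is_multivector_one_vector: "is_multivector 1 (one_vector f)"
  using is_multivector_one_vector_wedge[of 0 "axis {} 1" f]
  by (simp add: wedge_one) (simp add: is_multivector_def axis_def)

text \<open>By degree only the component at \<open>{}\<close> survives, and there no sign
  distinguishes the right derivative from the left one.\<close>

lemma right_deriv_one_vector: "right_deriv i (one_vector f) = f i *\<^sub>R axis {} 1"
proof -
  have "right_deriv i P $ {} = left_deriv i P $ {}" for P
    by (simp add: right_deriv_def left_deriv_def shuffle_sign_def)
  moreover have "right_deriv i (one_vector f) $ K = 0" if "K \<noteq> {}" for K
    using that is_multivector_one_vector[of f]
    by (simp add: right_deriv_def is_multivector_def card_insert_if)
  ultimately show ?thesis
    by (simp add: vec_eq_iff) (simp add: left_deriv_one_vector axis_def)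
qed

lemma right_deriv_one_vector_wedge:
  "right_deriv i (one_vector f \<and>\<^sub>e one_vector g) = g i *\<^sub>R one_vector f - f i *\<^sub>R one_vector g"
proof -
  have "right_deriv i (one_vector f \<and>\<^sub>e one_vector g) =
    (\<Sum>j\<in>UNIV. \<Sum>k\<in>UNIV. (f j * g k) *\<^sub>R ((if i = k then ext_gen j else 0) - (if i = j then ext_gen k else 0)))"
    by (simp add: one_vector_wedge_expand linear_sum[OF linear_right_deriv]
       linear_scale[OF linear_right_deriv] right_deriv_ext_gen_wedge_ext_gen)
  also have "\<dots> = (\<Sum>j\<in>UNIV. \<Sum>k\<in>UNIV. if i = k then (f j * g k) *\<^sub>R ext_gen j else 0)
      - (\<Sum>k\<in>UNIV. \<Sum>j\<in>UNIV. if i = j then (f j * g k) *\<^sub>R ext_gen k else 0)"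
    by (subst (3) sum.swap, unfold sum_subtractf[symmetric])
      (intro sum.cong; auto simp: algebra_simps)
  finally show ?thesis
    by (simp add: sum.delta one_vector_def scaleR_sum_right mult.commute)
qed

lemma linear_one_vector_nth: "linear (\<lambda>u :: real ^ 'i::finite. one_vector (($) u))"
  by (auto intro!: linearI simp: one_vector_def algebra_simps sum.distrib scaleR_sum_right)

lemma one_vector_axis: "one_vector (($) (axis i 1)) = ext_gen i"
proof -
  have "one_vector (($) (axis i 1)) = (\<Sum>j\<in>UNIV. if j = i then ext_gen i else 0)"
    unfolding one_vector_def by (intro sum.cong) (auto simp: axis_def)
  then show ?thesis by simp
qed

lemma one_vector_inj: "one_vector f = one_vector g \<longleftrightarrow> f = g"
proof
  assume *: "one_vector f = one_vector g"
  have "f i = g i" for i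
    using arg_cong[OF *, of "\<lambda>P. left_deriv i P $ {}"]
    by (simp add: left_deriv_one_vector axis_def)
  then show "f = g" by (rule ext)
qed simp

text \<open>A covector annihilating all factors contracts their product to zero, while contraction with
  a nonzero covector is injective in top degree.\<close>

lemma span_factors_of_nonzero_wedge:
  fixes v :: "'b \<Rightarrow> real ^ 'i::finite"
  assumes nz: "wedge_list (map (\<lambda>k. one_vector (($) (v k))) ks) \<noteq> 0"
    and len: "length ks = CARD('i)"
  shows "span (v ` set ks) = UNIV"
proof (rule ccontr)
  assume "span (v ` set ks) \<noteq> UNIV"
  then obtain w where w: "w \<noteq> 0" "\<And>k. k \<in> set ks \<Longrightarrow> w \<bullet> v k = 0"
    using span_not_UNIV_orthogonal[of "v ` set ks"] by (auto intro: span_base)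
  \<comment> \<open>\<open>c\<close> is contraction with the covector \<open>w\<close>. It kills
    every factor \<open>v k\<close>, so by the Leibniz rule it kills their product.\<close>
  define c where "c P = (\<Sum>i\<in>UNIV. w $ i *\<^sub>R left_deriv i P)" for P
  have c_wedge: "c (one_vector f \<and>\<^sub>e P) = (\<Sum>i\<in>UNIV. w $ i * f i) *\<^sub>R P - one_vector f \<and>\<^sub>e c P" for f P
    by (simp add: c_def left_deriv_one_vector_wedge algebra_simps sum_subtractf wedge_sum_right
        wedge_linear_simps scaleR_sum_left)
  define W where "W ls = wedge_list (map (\<lambda>k. one_vector (($) (v k))) ls)" for ls
  have W_simps: "W [] = axis {} 1" "W (k # ls) = one_vector (($) (v k)) \<and>\<^sub>e W ls" for k ls
    by (auto simp: W_def wedge_list_def)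
  have "c (W ls) = 0 \<and> is_multivector (length ls) (W ls)" if "set ls \<subseteq> set ks" for ls
    using that
  proof (induction ls)
    case Nil
    then show ?case
      by (simp add: W_simps c_def left_deriv_one is_multivector_def) (simp add: axis_def)
  next
    case (Cons k ls)
    moreover have "(\<Sum>i\<in>UNIV. w $ i * v k $ i) = 0"
      using w(2)[of k] Cons.prems by (simp add: inner_vec_def)
    ultimately show ?case
      by (simp add: W_simps c_wedge is_multivector_one_vector_wedge wedge_linear_simps)
  qed
  then have cW: "c (W ks) = 0" and deg: "is_multivector CARD('i) (W ks)"
    using len by (metis order_refl)+
  obtain i where i: "w $ i \<noteq> 0" using w(1) by (auto simp: vec_eq_iff)
  \<comment> \<open>Every \<open>j\<close> other than \<open>i\<close> already lies in
    \<open>- {i}\<close>, so at this index only the derivative by \<open>i\<close> contributes to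
    \<open>c\<close>, and it reads off the top coefficient of the product up to sign.\<close>
  have zero: "left_deriv j (W ks) $ (- {i}) = 0" if "j \<noteq> i" for j
    using that by (simp add: left_deriv_def)
  have "c (W ks) $ (- {i}) = (\<Sum>j\<in>UNIV. if j = i then w $ i * left_deriv i (W ks) $ (- {i}) else 0)"
    unfolding c_def sum_component by (intro sum.cong) (auto simp: zero)
  moreover have "insert i (- {i}) = UNIV" by auto
  ultimately have "W ks $ UNIV = 0"
    using i cW by (simp add: sum.delta left_deriv_def shuffle_sign_def)
  moreover have "W ks $ K = 0" if "K \<noteq> UNIV" for K
  proof -
    have "card K < CARD('i)" using that by (intro psubset_card_mono) auto
    then show ?thesis using deg by (auto simp: is_multivector_def)
  qed
  ultimately have "W ks = 0" by (metis vec_eq_iff zero_index)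
  then show False using nz by (simp add: W_def)
qed

text \<open>Bilinearity extends membership from \<open>V\<close> to all vectors, one factor at a
  time; monomials of degree two are, up to sign, products of two axis vectors.\<close>

lemma bivector_in_span_wedges:
  fixes P :: "'i::finite ext"
  assumes P: "is_multivector 2 P" and span: "span V = UNIV"
  shows "P \<in> span {one_vector (($) u) \<and>\<^sub>e one_vector (($) v) | u v. u \<in> V \<and> v \<in> V}" (is "_ \<in> span ?S")
proof -
  have base: "one_vector (($) u) \<and>\<^sub>e one_vector (($) v) \<in> span ?S" if "u \<in> V" "v \<in> V" for u v
    using that by (intro span_base) blast
  have lin: "linear (\<lambda>u :: real ^ 'i. one_vector (($) u) \<and>\<^sub>e Q)"
    "linear (\<lambda>u :: real ^ 'i. Q \<and>\<^sub>e one_vector (($) u))" for Q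
    using linear_compose[OF linear_one_vector_nth] bilinear_wedge
    unfolding bilinear_def o_def by blast+
  have 1: "one_vector (($) u) \<and>\<^sub>e one_vector (($) v) \<in> span ?S" if "u \<in> V" for u v
  proof -
    have "v \<in> span V" using span by simp
    then show ?thesis
    proof (induction rule: span_induct)
      case base
      show ?case
        unfolding subspace_def
        by (auto simp: linear_0[OF lin(2)] linear_add[OF lin(2)] linear_scale[OF lin(2)] span_zero
           intro: span_add span_scale)
    qed (use that base in blast)
  qed
  have 2: "one_vector (($) u) \<and>\<^sub>e one_vector (($) v) \<in> span ?S" for u v :: "real ^ 'i"
  proof -
    have "u \<in> span V" using span by simp
    then show ?thesis
    proof (induction rule: span_induct)
      case base
      show ?case
        unfolding subspace_def
        by (auto simp: linear_0[OF lin(1)] linear_add[OF lin(1)] linear_scale[OF lin(1)] span_zero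
           intro: span_add span_scale)
    qed (use 1 in blast)
  qed
  have "P $ K *\<^sub>R axis K 1 \<in> span ?S" for K
  proof (cases "card K = 2")
    case True
    then obtain i j where K: "K = {i, j}" "i \<noteq> j" by (auto simp: card_2_iff)
    then have "axis K 1 = shuffle_sign {i} {j} *\<^sub>R (ext_gen i \<and>\<^sub>e ext_gen j)"
      by (simp add: ext_gen_wedge_ext_gen shuffle_sign_square)
    then show ?thesis unfolding one_vector_axis[symmetric] using 2 by (auto intro!: span_scale)
  next
    case False
    then show ?thesis using P by (simp add: is_multivector_def span_zero)
  qed
  then have "(\<Sum>K\<in>UNIV. P $ K *\<^sub>R axis K 1) \<in> span ?S" by (intro span_sum) auto
  moreover have "(\<Sum>K\<in>UNIV. P $ K *\<^sub>R axis K 1) = P"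
    by (simp add: vec_eq_iff axis_def if_distrib sum.delta cong: if_cong)
  ultimately show ?thesis by simp
qed

subsection \<open>Linear vector fields and invariant quadratic fields\<close>

lemma linear_vector_matrix: "linear (\<lambda>x :: real ^ 'n::finite. x v* A)"
  by (intro linearI) (simp_all add: vector_matrix_left_distrib scaleR_vector_matrix_assoc)

lemma linear_one_vector_matrix: "linear (\<lambda>x :: real ^ 'n::finite. one_vector (($) (x v* A)))"
  using linear_compose[OF linear_vector_matrix linear_one_vector_nth] by (simp add: o_def)

lemmas one_vector_nth_simps =
  linear_add[OF linear_one_vector_nth] linear_scale[OF linear_one_vector_nth]

lemma vec_eq_sum_axis: "u = (\<Sum>i\<in>UNIV. u $ i *\<^sub>R axis i (1 :: real))"
  by (simp add: vec_eq_iff axis_def if_distrib sum.delta cong: if_cong)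

lemma sum_axis_image:
  assumes "linear f"
  shows "(\<Sum>i\<in>UNIV. u $ i *\<^sub>R f (axis i (1 :: real))) = f u"
  using arg_cong[OF vec_eq_sum_axis[of u], of f]
  unfolding linear_sum[OF assms] linear_scale[OF assms] by (rule sym)

text \<open>As \<open>elem_mat i j\<close> goes to the field with value \<open>x $ i\<close> along
  the \<open>j\<close>-th axis, points are row vectors and matrices act on them from the
  right.\<close>

lemma J1_eq: "J1 A x = one_vector (($) (x v* A))"
  unfolding J1_def one_vector_def vector_matrix_mult_def
  by (subst sum.swap) (simp add: scaleR_sum_left mult.commute)

lemma J1_axis: "J1 A x = (\<Sum>p\<in>UNIV. A $ fst p $ snd p *\<^sub>R J1 (elem_mat (fst p) (snd p)) x)"
proof -
  have "J1 (elem_mat i j) x = x $ i *\<^sub>R ext_gen j" for i j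
  proof -
    have "(x v* elem_mat i j) $ l = (x $ i *\<^sub>R axis j 1) $ l" for l
    proof -
      have "(x v* elem_mat i j) $ l = (\<Sum>k\<in>UNIV. if k = i then x $ i * axis j 1 $ l else 0)"
        unfolding vector_matrix_mult_def vec_lambda_beta
        by (intro sum.cong) (auto simp: elem_mat_def axis_def)
      then show ?thesis by simp
    qed
    then have "x v* elem_mat i j = x $ i *\<^sub>R axis j 1" by (simp add: vec_eq_iff)
    then show ?thesis by (simp add: J1_eq one_vector_nth_simps one_vector_axis)
  qed
  moreover have "J1 A x = (\<Sum>p\<in>UNIV. (A $ fst p $ snd p * x $ fst p) *\<^sub>R ext_gen (snd p))"
    unfolding J1_def sum.cartesian_product by (simp add: case_prod_unfold)
  ultimately show ?thesis by simp
qed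

lemma gl_ext_eq: "gl_ext A = one_vector (\<lambda>p. A $ fst p $ snd p)"
  by (simp add: gl_ext_def one_vector_def sum.cartesian_product case_prod_unfold)

lemma linear_gl_ext: "linear gl_ext"
  by (intro linearI) (simp_all add: gl_ext_def algebra_simps sum.distrib scaleR_sum_right)

section \<open>Brackets with linear vector fields\<close>

text \<open>The part of \<open>sn_bracket P (J1 A)\<close> that does not differentiate
  \<open>P\<close>. It acts as the derivation extending \<open>u \<mapsto> u v* A\<close>, as
  verified below for one-vectors and products of two.\<close>

definition matrix_action :: "real ^ 'n ^ 'n \<Rightarrow> 'n::finite ext \<Rightarrow> 'n ext" where
  "matrix_action A P = (\<Sum>i\<in>UNIV. right_deriv i P \<and>\<^sub>e one_vector (($) (axis i 1 v* A)))"

lemma linear_matrix_action: "linear (matrix_action A)"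
  by (intro linearI) (simp_all add: matrix_action_def linear_add[OF linear_right_deriv]
      linear_scale[OF linear_right_deriv] wedge_linear_simps sum.distrib scaleR_sum_right)

lemma matrix_action_one_vector:
  "matrix_action A (one_vector (($) u)) = one_vector (($) (u v* A))"
  unfolding matrix_action_def right_deriv_one_vector wedge_linear_simps one_wedge
  by (rule sum_axis_image[OF linear_one_vector_matrix])

lemma matrix_action_wedge:
  "matrix_action A (one_vector (($) u) \<and>\<^sub>e one_vector (($) v)) =
     one_vector (($) (u v* A)) \<and>\<^sub>e one_vector (($) v) + one_vector (($) u) \<and>\<^sub>e one_vector (($) (v v* A))"
proof -
  have "matrix_action A (one_vector (($) u) \<and>\<^sub>e one_vector (($) v)) =
      one_vector (($) u) \<and>\<^sub>e (\<Sum>i\<in>UNIV. v $ i *\<^sub>R one_vector (($) (axis i 1 v* A)))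
      - one_vector (($) v) \<and>\<^sub>e (\<Sum>i\<in>UNIV. u $ i *\<^sub>R one_vector (($) (axis i 1 v* A)))"
    by (simp add: matrix_action_def right_deriv_one_vector_wedge wedge_linear_simps wedge_sum_right
        sum_subtractf)
  then show ?thesis
    unfolding sum_axis_image[OF linear_one_vector_matrix]
    by (simp add: one_vector_anticommute[of "($) v"])
qed

lemma pd_has_derivative:
  assumes "(P has_derivative D) (at x)"
  shows "pd i P x = D (axis i 1)"
  using frechet_derivative_at[OF assms] by (simp add: pd_def)

text \<open>The partial derivatives of \<open>J1 A\<close> are constant, which gives
  \<open>matrix_action\<close>; its left derivatives are scalars, so the other sum is the
  directional derivative of \<open>P\<close> along \<open>J1 A\<close>.\<close>

lemma sn_bracket_J1:
  assumes D: "(P has_derivative D) (at x)"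
  shows "sn_bracket P (J1 A) x = matrix_action A (P x) - D (x v* A)"
proof -
  have "(J1 A has_derivative J1 A) (at x)"
    unfolding J1_eq[abs_def] by (rule linear_imp_has_derivative[OF linear_one_vector_matrix])
  then have "pd i (J1 A) x = one_vector (($) (axis i 1 v* A))" for i
    by (simp add: pd_has_derivative J1_eq)
  moreover have "(\<Sum>i\<in>UNIV. (x v* A) $ i *\<^sub>R D (axis i 1)) = D (x v* A)"
    by (rule sum_axis_image[OF has_derivative_linear[OF D]])
  ultimately show ?thesis
    unfolding sn_bracket_def J1_eq left_deriv_one_vector pd_has_derivative[OF D]
    by (simp add: sum_subtractf wedge_linear_simps wedge_one matrix_action_def)
qed

lemma commute_if_sn_bracket_J1_eq_0:
  assumes "\<And>x. sn_bracket (J1 A) (J1 B) x = 0"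
  shows "A ** B = B ** A"
proof -
  have "x v* (A ** B) = x v* (B ** A)" for x
  proof -
    have "(J1 A has_derivative J1 A) (at x)"
      unfolding J1_eq[abs_def] by (rule linear_imp_has_derivative[OF linear_one_vector_matrix])
    from sn_bracket_J1[OF this, of B] assms[of x]
    have "one_vector (($) (x v* A v* B)) = one_vector (($) (x v* B v* A))"
      by (simp add: J1_eq matrix_action_one_vector)
    then show ?thesis
      unfolding one_vector_inj vec_nth_inject vector_matrix_mul_assoc .
  qed
  \<comment> \<open>Transposition turns the action on row vectors into one on column vectors, for
    which \<open>matrix_eq\<close> is stated.\<close>
  then have "transpose (A ** B) *v x = transpose (B ** A) *v x" for x by simp
  then have "transpose (A ** B) = transpose (B ** A)" by (simp add: matrix_eq)
  then show ?thesis by (simp add: transpose_iff)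
qed

section \<open>Invariant quadratic fields\<close>

text \<open>The last condition is the vanishing of the bracket of \<open>P\<close> with \<open>J1 A\<close>, the left-hand side
  being the derivative of \<open>P\<close> along \<open>J1 A\<close>.\<close>

definition invariant_quadratic ::
    "(real ^ 'n ^ 'n) set \<Rightarrow> 'n::finite polyvector_field \<Rightarrow> bool" where
  "invariant_quadratic S P \<longleftrightarrow>
     (\<exists>B. bilinear B \<and> (\<forall>x y. B x y = B y x) \<and> (\<forall>x. P x = B x x) \<and>
       (\<forall>A\<in>S. \<forall>x. 2 *\<^sub>R B x (x v* A) = matrix_action A (B x x)))"

text \<open>Used both to build \<open>J a\<close> from its generators and to form the difference of
  \<Lambda> and \<open>J a\<close>.\<close>

lemma invariant_quadratic_combination:
  assumes "invariant_quadratic S P" "invariant_quadratic S Q"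
  shows "invariant_quadratic S (\<lambda>x. c *\<^sub>R P x + d *\<^sub>R Q x)"
proof -
  from assms obtain B C where
    B: "bilinear B" "\<forall>x y. B x y = B y x" "\<forall>x. P x = B x x"
      "\<forall>A\<in>S. \<forall>x. 2 *\<^sub>R B x (x v* A) = matrix_action A (B x x)" and
    C: "bilinear C" "\<forall>x y. C x y = C y x" "\<forall>x. Q x = C x x"
      "\<forall>A\<in>S. \<forall>x. 2 *\<^sub>R C x (x v* A) = matrix_action A (C x x)"
    unfolding invariant_quadratic_def by blast
  have "bilinear (\<lambda>x y. c *\<^sub>R B x y + d *\<^sub>R C x y)"
    using B(1) C(1) by (auto simp: bilinear_def intro!: linear_compose_add linear_compose_scale_right)
  moreover have "\<forall>x y. c *\<^sub>R B x y + d *\<^sub>R C x y = c *\<^sub>R B y x + d *\<^sub>R C y x"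
    using B(2) C(2) by metis
  moreover have "2 *\<^sub>R (c *\<^sub>R B x (x v* A) + d *\<^sub>R C x (x v* A)) =
      matrix_action A (c *\<^sub>R B x x + d *\<^sub>R C x x)" if "A \<in> S" for A x
  proof -
    have "2 *\<^sub>R (c *\<^sub>R B x (x v* A) + d *\<^sub>R C x (x v* A)) =
        c *\<^sub>R (2 *\<^sub>R B x (x v* A)) + d *\<^sub>R (2 *\<^sub>R C x (x v* A))"
      by (simp add: scaleR_add_right mult.commute)
    also have "\<dots> = c *\<^sub>R matrix_action A (B x x) + d *\<^sub>R matrix_action A (C x x)"
      using B(4) C(4) that by simp
    finally show ?thesis
      by (simp add: linear_add[OF linear_matrix_action] linear_scale[OF linear_matrix_action])
  qed
  ultimately show ?thesis
    unfolding invariant_quadratic_def using B(3) C(3) by (intro exI[of _ "\<lambda>x y. c *\<^sub>R B x y + d *\<^sub>R C x y"]) simp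
qed

text \<open>When \<open>C\<close> commutes with \<open>A\<close>, moving \<open>x\<close> along
  \<open>J1 C\<close> and then applying \<open>A\<close> equals applying \<open>A\<close> and then
  \<open>C\<close>; hence differentiating the product along \<open>J1 C\<close> amounts to
  \<open>matrix_action C\<close>.\<close>

lemma invariant_quadratic_J1_wedge:
  assumes comm: "\<And>A B. A \<in> S \<Longrightarrow> B \<in> S \<Longrightarrow> A ** B = B ** A" and "A \<in> S" "A' \<in> S"
  shows "invariant_quadratic S (\<lambda>x. J1 A x \<and>\<^sub>e J1 A' x)"
proof -
  define w where "w x y = J1 A x \<and>\<^sub>e J1 A' y" for x y
  define B where "B x y = (1 / 2) *\<^sub>R (w x y + w y x)" for x y
  have lin: "linear (J1 C)" for C :: "real ^ 'a ^ 'a"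
    unfolding J1_eq[abs_def] by (rule linear_one_vector_matrix)
  have "linear (w x)" "linear (\<lambda>y. w y x)" for x
    using bilinear_wedge linear_compose[OF lin] unfolding w_def bilinear_def o_def by blast+
  then have "bilinear B"
    by (auto simp: bilinear_def B_def intro!: linear_compose_add linear_compose_scale_right)
  moreover have "\<forall>x y. B x y = B y x" by (simp add: B_def add.commute)
  moreover have diag: "B x x = w x x" for x
    by (simp add: B_def flip: scaleR_2)
  moreover have "2 *\<^sub>R B x (x v* C) = matrix_action C (B x x)" if "C \<in> S" for C x
  proof -
    have "x v* A v* C = x v* C v* A" "x v* A' v* C = x v* C v* A'"
      using comm assms that by (simp_all add: vector_matrix_mul_assoc)
    then show ?thesis
      unfolding diag by (simp add: B_def w_def J1_eq matrix_action_wedge)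
  qed
  ultimately show ?thesis
    unfolding invariant_quadratic_def using diag w_def by (intro exI[of _ B]) auto
qed

lemma invariant_quadratic_stabilizer:
  fixes \<Lambda> :: "'n::finite polyvector_field"
  assumes quad: "\<And>K. homogeneous_quadratic (\<lambda>x. \<Lambda> x $ K)"
  shows "invariant_quadratic (stabilizer \<Lambda>) \<Lambda>"
proof -
  have "\<forall>K. \<exists>c. \<forall>x. \<Lambda> x $ K = (\<Sum>i\<in>UNIV. \<Sum>j\<in>UNIV. c i j * x $ i * x $ j)"
    using quad unfolding homogeneous_quadratic_def by blast
  from choice[OF this] obtain c
    where c: "\<And>K x. \<Lambda> x $ K = (\<Sum>i\<in>UNIV. \<Sum>j\<in>UNIV. c K i j * x $ i * x $ j)"
    by blast
  define q where "q x y = (\<chi> K. \<Sum>i\<in>UNIV. \<Sum>j\<in>UNIV. c K i j * x $ i * y $ j)" for x y :: "real ^ 'n"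
  \<comment> \<open>The coefficients \<open>c K i j\<close> need not be symmetric in
    \<open>i\<close> and \<open>j\<close>; symmetrizing keeps the diagonal values and makes the
    derivative at \<open>x\<close> equal to \<open>2 *\<^sub>R B x h\<close>.\<close>
  define B where "B x y = (1 / 2) *\<^sub>R (q x y + q y x)" for x y
  have "linear (q x)" "linear (\<lambda>y. q y x)" for x
    by (intro linearI; simp add: q_def vec_eq_iff algebra_simps sum.distrib sum_distrib_left)+
  then have bil: "bilinear B"
    by (auto simp: bilinear_def B_def intro!: linear_compose_add linear_compose_scale_right)
  have sym: "B x y = B y x" for x y by (simp add: B_def add.commute)
  have diag: "\<Lambda> x = B x x" for x
    by (simp add: B_def q_def vec_eq_iff c flip: scaleR_2)
  interpret bounded_bilinear B using bil by (simp add: bilinear_conv_bounded_bilinear)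
  have "((\<lambda>x. B x x) has_derivative (\<lambda>h. B x h + B h x)) (at x)" for x
    by (rule FDERIV) (rule has_derivative_ident)+
  moreover have "B x h + B h x = 2 *\<^sub>R B x h" for x h
    unfolding sym[of h x] scaleR_2 ..
  moreover have "(\<lambda>x. B x x) = \<Lambda>"
    by (rule ext) (rule diag[symmetric])
  ultimately have der: "(\<Lambda> has_derivative (\<lambda>h. 2 *\<^sub>R B x h)) (at x)" for x
    by simp
  have "2 *\<^sub>R B x (x v* A) = matrix_action A (B x x)" if "A \<in> stabilizer \<Lambda>" for A x
    using sn_bracket_J1[OF der, of A x] that by (simp add: stabilizer_def diag)
  then show ?thesis
    unfolding invariant_quadratic_def using bil sym diag by blast
qed

text \<open>The spanning hypothesis enters twice: with the invariance at \<open>x0\<close>, then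
  with the invariance at \<open>v + x0\<close> for arbitrary \<open>v\<close>.\<close>

lemma invariant_quadratic_eq_0:
  assumes inv: "invariant_quadratic S P"
    and span: "span ((\<lambda>A. x0 v* A) ` S) = UNIV" and "P x0 = 0"
  shows "P x = 0"
proof -
  from inv obtain B where B: "bilinear B" "\<And>x y. B x y = B y x" "\<And>x. P x = B x x"
    "\<And>A x. A \<in> S \<Longrightarrow> 2 *\<^sub>R B x (x v* A) = matrix_action A (B x x)"
    unfolding invariant_quadratic_def by blast
  have lin: "linear (B v)" for v using B(1) by (simp add: bilinear_def)
  have zero: "B v u = 0" if "\<And>A. A \<in> S \<Longrightarrow> B v (x0 v* A) = 0" for v u
    using linear_eq_0_on_span[OF lin, of "(\<lambda>A. x0 v* A) ` S"] that span by auto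
  have x0: "B x0 u = 0" for u
  proof (rule zero)
    fix A assume "A \<in> S"
    then have "2 *\<^sub>R B x0 (x0 v* A) = 0"
      using B(4) assms(3) B(3) by (simp add: linear_0[OF linear_matrix_action])
    then show "B x0 (x0 v* A) = 0" by simp
  qed
  have "B v u = 0" for v u
  proof (rule zero)
    fix A assume A: "A \<in> S"
    \<comment> \<open>Since \<open>B x0\<close> vanishes, the shift by \<open>x0\<close> leaves the
      diagonal value unchanged. Comparing the invariance at \<open>v + x0\<close> with that at
      \<open>v\<close> isolates \<open>B v (x0 v* A)\<close>.\<close>
    have exp: "B (v + x0) (v + x0) = B v v" "B (v + x0) ((v + x0) v* A) = B v (v v* A) + B v (x0 v* A)"
      using x0 B(2)[of _ x0]
      by (simp_all add: bilinear_ladd[OF B(1)] bilinear_radd[OF B(1)] vector_matrix_left_distrib)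
    have "2 *\<^sub>R B v (v v* A) + 2 *\<^sub>R B v (x0 v* A) = 2 *\<^sub>R B v (v v* A)"
      using B(4)[OF A, of "v + x0"] B(4)[OF A, of v] unfolding exp scaleR_add_right by simp
    then show "B v (x0 v* A) = 0" by simp
  qed
  then show ?thesis using B(3) by simp
qed

subsection \<open>The exterior algebra of the general linear Lie algebra\<close>

lemma linear_J: "linear (\<lambda>a. J a x)"
  by (intro linearI) (simp_all add: J_def algebra_simps sum.distrib scaleR_sum_right)

lemma increasing_list_doubleton:
  assumes "to_nat i < to_nat j"
  shows "increasing_list {i, j} = [i, j]"
proof -
  have "{to_nat j} - {to_nat i} = {to_nat j}" using assms by auto
  then show ?thesis using assms by (simp add: increasing_list_def)
qed

lemma J_axis: "J (axis K 1) x =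
    wedge_list (map (\<lambda>p. J1 (elem_mat (fst p) (snd p)) x) (increasing_list K))" (is "_ = ?w K")
proof -
  have "J (axis K 1) x = (\<Sum>L\<in>UNIV. if L = K then ?w K else 0)"
    unfolding J_def case_prod_unfold by (intro sum.cong) (auto simp: axis_def)
  then show ?thesis by simp
qed

lemma J1_anticommute: "J1 A x \<and>\<^sub>e J1 B x = - (J1 B x \<and>\<^sub>e J1 A x)"
  unfolding J1_eq by (rule one_vector_anticommute)

text \<open>\<open>J\<close> is given on increasing monomials; the sign of a pair in the wrong order
  matches the anticommutation of the two linear fields, and a repeated generator gives zero on both
  sides.\<close>

lemma J_ext_gen_wedge_ext_gen:
  "J (ext_gen p \<and>\<^sub>e ext_gen q) x =
     J1 (elem_mat (fst p) (snd p)) x \<and>\<^sub>e J1 (elem_mat (fst q) (snd q)) x" (is "_ = ?h p \<and>\<^sub>e ?h q")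
proof -
  have less: "J (axis {p, q} 1) x = ?h p \<and>\<^sub>e ?h q" if "to_nat p < to_nat q" for p q :: "'a \<times> 'a"
    by (simp add: J_axis increasing_list_doubleton[OF that] wedge_list_def wedge_one)
  consider "p = q" | "to_nat p < to_nat q" | "to_nat q < to_nat p"
    using inj_to_nat[THEN injD, of p q] by (meson nat_neq_iff)
  then show ?thesis
  proof cases
    case 1
    have "?h p \<and>\<^sub>e ?h p = 0"
      using J1_anticommute[of "elem_mat (fst p) (snd p)" x "elem_mat (fst p) (snd p)"]
      by (simp add: eq_neg_iff_add_eq_0 flip: scaleR_2)
    then show ?thesis
      using 1 by (simp add: ext_gen_wedge_ext_gen linear_0[OF linear_J])
  next
    case 2
    then have "p \<noteq> q" by auto
    then show ?thesis
      using 2 by (simp add: ext_gen_wedge_ext_gen shuffle_sign_singletons less)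
  next
    case 3
    then have "p \<noteq> q" by auto
    then have "J (ext_gen p \<and>\<^sub>e ext_gen q) x = - J (axis {q, p} 1) x"
      using 3 by (simp add: ext_gen_wedge_ext_gen shuffle_sign_singletons linear_neg[OF linear_J]
          insert_commute)
    then show ?thesis
      using less[OF 3] J1_anticommute by metis
  qed
qed

lemma J_gl_ext_wedge: "J (gl_ext A \<and>\<^sub>e gl_ext B) x = J1 A x \<and>\<^sub>e J1 B x"
proof -
  let ?h = "\<lambda>p. J1 (elem_mat (fst p) (snd p)) x"
  have "J (gl_ext A \<and>\<^sub>e gl_ext B) x =
      (\<Sum>p\<in>UNIV. \<Sum>q\<in>UNIV. (A $ fst p $ snd p * B $ fst q $ snd q) *\<^sub>R (?h p \<and>\<^sub>e ?h q))"
    unfolding gl_ext_eq one_vector_wedge_expand linear_sum[OF linear_J] linear_scale[OF linear_J]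
      J_ext_gen_wedge_ext_gen ..
  also have "\<dots> = J1 A x \<and>\<^sub>e J1 B x"
    unfolding J1_axis[of A] J1_axis[of B] wedge_sum_left
    unfolding wedge_sum_right wedge_linear_simps scaleR_sum_right scaleR_scaleR
    by (simp only: mult.commute)
  finally show ?thesis .
qed

section \<open>The algebraic Schouten bracket on commuting matrices\<close>

text \<open>Puts the commutator of arbitrary matrices into the form of the sums over elementary
  matrices that define \<open>gl_bracket\<close>.\<close>

lemma gl_ext_mat_commutator:
  "gl_ext (mat_commutator A B) = (\<Sum>i\<in>UNIV. \<Sum>j\<in>UNIV. \<Sum>k\<in>UNIV. \<Sum>l\<in>UNIV.
     (A $ i $ j * B $ k $ l) *\<^sub>R gl_ext (mat_commutator (elem_mat i j) (elem_mat k l)))"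
proof -
  have bil: "bilinear (\<lambda>X Y :: real ^ 'a ^ 'a. gl_ext (mat_commutator X Y))"
  proof -
    have "(X + Z) ** Y = X ** Y + Z ** Y" "(c *\<^sub>R X) ** Y = c *\<^sub>R (X ** Y)"
      "Y ** (c *\<^sub>R X) = c *\<^sub>R (Y ** X)" for X Y Z :: "real ^ 'a ^ 'a" and c
      by (simp_all add: matrix_matrix_mult_def vec_eq_iff distrib_right sum.distrib
          sum_distrib_left mult.assoc mult.left_commute)
    then have "linear (\<lambda>X. mat_commutator X Y)" "linear (\<lambda>X. mat_commutator Y X)"
      for Y :: "real ^ 'a ^ 'a"
      by (intro linearI; simp add: mat_commutator_def matrix_add_ldistrib scaleR_diff_right)+
    then show ?thesis
      using linear_compose[OF _ linear_gl_ext] unfolding bilinear_def o_def by blast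
  qed
  have exp: "X = (\<Sum>i\<in>UNIV. \<Sum>j\<in>UNIV. X $ i $ j *\<^sub>R elem_mat i j)" for X :: "real ^ 'a ^ 'a"
  proof -
    have "(\<Sum>i\<in>UNIV. \<Sum>j\<in>UNIV. X $ i $ j *\<^sub>R elem_mat i j) = (\<Sum>i\<in>UNIV. axis i (X $ i))"
    proof (rule sum.cong[OF refl])
      fix i
      have "axis i (X $ i) = axis i (\<Sum>j\<in>UNIV. X $ i $ j *\<^sub>R axis j (1 :: real))"
        using vec_eq_sum_axis[of "X $ i"] by simp
      moreover have "linear (axis i :: real ^ 'a \<Rightarrow> _)"
        by (intro linearI) (simp_all add: axis_def vec_eq_iff)
      ultimately show "(\<Sum>j\<in>UNIV. X $ i $ j *\<^sub>R elem_mat i j) = axis i (X $ i)"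
        by (simp add: elem_mat_def linear_sum linear_scale)
    qed
    also have "\<dots> = X"
    proof -
      have "(\<Sum>i\<in>UNIV. axis i (X $ i)) $ k = (\<Sum>i\<in>UNIV. if i = k then X $ k else 0)" for k
        unfolding sum_component by (intro sum.cong) (auto simp: axis_def)
      then show ?thesis by (simp add: vec_eq_iff)
    qed
    finally show ?thesis ..
  qed
  have left: "gl_ext (mat_commutator (sum f I) Y) = (\<Sum>i\<in>I. gl_ext (mat_commutator (f i) Y))"
    and right: "gl_ext (mat_commutator Y (sum f I)) = (\<Sum>i\<in>I. gl_ext (mat_commutator Y (f i)))"
    for f :: "'a \<Rightarrow> real ^ 'a ^ 'a" and I Y
    using bil linear_sum unfolding bilinear_def by blast+
  have "gl_ext (mat_commutator A B) = gl_ext (mat_commutator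
      (\<Sum>i\<in>UNIV. \<Sum>j\<in>UNIV. A $ i $ j *\<^sub>R elem_mat i j) (\<Sum>k\<in>UNIV. \<Sum>l\<in>UNIV. B $ k $ l *\<^sub>R elem_mat k l))"
    using exp[of A] exp[of B] by simp
  then show ?thesis
    unfolding left
    unfolding right bilinear_lmul[OF bil] bilinear_rmul[OF bil] scaleR_sum_right scaleR_scaleR
    by (simp only: mult.commute)
qed

lemma bilinear_gl_bracket: "bilinear gl_bracket"
  unfolding bilinear_def
  by (intro conjI allI linearI)
    (simp_all add: gl_bracket_def linear_add[OF linear_right_deriv] linear_add[OF linear_left_deriv]
      linear_scale[OF linear_right_deriv] linear_scale[OF linear_left_deriv] wedge_linear_simps
      sum.distrib scaleR_sum_right)

lemma gl_bracket_wedge: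
  "gl_bracket (gl_ext A \<and>\<^sub>e gl_ext B) (gl_ext C \<and>\<^sub>e gl_ext D) =
     gl_ext A \<and>\<^sub>e gl_ext (mat_commutator B C) \<and>\<^sub>e gl_ext D
     - gl_ext A \<and>\<^sub>e gl_ext (mat_commutator B D) \<and>\<^sub>e gl_ext C
     - gl_ext B \<and>\<^sub>e gl_ext (mat_commutator A C) \<and>\<^sub>e gl_ext D
     + gl_ext B \<and>\<^sub>e gl_ext (mat_commutator A D) \<and>\<^sub>e gl_ext C"
proof -
  have r: "right_deriv (i, j) (gl_ext A \<and>\<^sub>e gl_ext B) = B $ i $ j *\<^sub>R gl_ext A - A $ i $ j *\<^sub>R gl_ext B" for i j
    by (simp add: gl_ext_eq right_deriv_one_vector_wedge)
  have l: "left_deriv (i, j) (gl_ext C \<and>\<^sub>e gl_ext D) = C $ i $ j *\<^sub>R gl_ext D - D $ i $ j *\<^sub>R gl_ext C" for i j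
    by (simp add: gl_ext_eq left_deriv_one_vector_wedge left_deriv_one_vector wedge_linear_simps wedge_one)
  show ?thesis
    \<comment> \<open>Expanding the commutators on the right as well makes both sides sums over the
      same four indices, so they are compared summand by summand.\<close>
    unfolding gl_ext_mat_commutator[of A] gl_ext_mat_commutator[of B] gl_bracket_def r l
      wedge_sum_left wedge_sum_right sum.distrib[symmetric] sum_subtractf[symmetric]
    by (intro sum.cong refl) (simp add: wedge_linear_simps algebra_simps)
qed

text \<open>On generators each of the four terms of \<open>gl_bracket_wedge\<close> contains a
  commutator of two members of \<open>S\<close>; bilinearity does the rest.\<close>

lemma gl_bracket_span_commuting:
  assumes comm: "\<And>A B. A \<in> S \<Longrightarrow> B \<in> S \<Longrightarrow> A ** B = B ** A"
    and a: "a \<in> wedge_square S" and b: "b \<in> wedge_square S"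
  shows "gl_bracket a b = 0"
proof -
  have "gl_bracket (gl_ext A \<and>\<^sub>e gl_ext B) (gl_ext C \<and>\<^sub>e gl_ext D) = 0"
    if "A \<in> S" "B \<in> S" "C \<in> S" "D \<in> S" for A B C D
    using that by (simp add: gl_bracket_wedge mat_commutator_def comm[of B] comm[of A]
        linear_0[OF linear_gl_ext] wedge_linear_simps)
  then have "gl_bracket p q = 0"
    if "p \<in> {gl_ext A \<and>\<^sub>e gl_ext B | A B. A \<in> S \<and> B \<in> S}"
      "q \<in> {gl_ext A \<and>\<^sub>e gl_ext B | A B. A \<in> S \<and> B \<in> S}" for p q
    using that by blast
  moreover have "bilinear (\<lambda>_ _. 0)"
    by (simp add: bilinear_def linear_zero)
  ultimately show ?thesis
    using bilinear_eq[OF bilinear_gl_bracket, of "\<lambda>_ _. 0"] a b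
    unfolding wedge_square_def by blast
qed

lemma is_multivector_wedge_square:
  assumes "a \<in> wedge_square S"
  shows "is_multivector 2 a"
  using assms unfolding wedge_square_def
proof (induction rule: span_induct)
  case base
  show ?case by (auto simp: subspace_def is_multivector_def)
next
  case (step a)
  then show ?case
    using is_multivector_one_vector_wedge[OF is_multivector_one_vector]
    by (auto simp: gl_ext_eq numeral_2_eq_2)
qed

lemma invariant_quadratic_J_wedge_square:
  fixes S :: "(real ^ 'n::finite ^ 'n) set"
  assumes comm: "\<And>A B. A \<in> S \<Longrightarrow> B \<in> S \<Longrightarrow> A ** B = B ** A" and a: "a \<in> wedge_square S"
  shows "invariant_quadratic S (J a)"
  using a unfolding wedge_square_def
proof (induction rule: span_induct_alt)
  case base
  have "invariant_quadratic S (\<lambda>x. 0)"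
    unfolding invariant_quadratic_def
    by (intro exI[of _ "\<lambda>_ _. 0"]) (simp add: bilinear_def linear_zero linear_0[OF linear_matrix_action])
  moreover have "J (0 :: ('n \<times> 'n) ext) = (\<lambda>x. 0)"
    by (rule ext) (rule linear_0[OF linear_J])
  ultimately show ?case by simp
next
  case (step c a b)
  then obtain A B where "a = gl_ext A \<and>\<^sub>e gl_ext B" "A \<in> S" "B \<in> S" by blast
  then have "invariant_quadratic S (J a)"
    using invariant_quadratic_J1_wedge[OF comm] by (simp add: J_gl_ext_wedge[abs_def])
  from invariant_quadratic_combination[OF this step(2), of c 1] show ?case
    by (simp add: linear_add[OF linear_J, abs_def] linear_scale[OF linear_J, abs_def])
qed

section \<open>Construction of the r-matrix\<close>

theorem theorem1:
  fixes \<Lambda> :: "'n::finite polyvector_field"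
    and Y :: "nat \<Rightarrow> 'n polyvector_field"
  assumes "quadratic_poisson \<Lambda>"
    and "\<And>i. i \<in> {1..CARD('n)} \<Longrightarrow> Y i \<in> J1 ` stabilizer \<Lambda>"
    and "\<And>i j x. i \<in> {1..CARD('n)} \<Longrightarrow> j \<in> {1..CARD('n)} \<Longrightarrow> sn_bracket (Y i) (Y j) x = 0"
    and "\<exists>x. wedge_list (map (\<lambda>i. Y i x) [1..<CARD('n) + 1]) \<noteq> 0"
  shows "\<exists>a \<in> wedge_square (stabilizer \<Lambda>). classical_r_matrix a \<and> \<Lambda> = J a"
proof -
  from assms(2) obtain A where A: "\<And>i. i \<in> {1..CARD('n)} \<Longrightarrow> A i \<in> stabilizer \<Lambda> \<and> Y i = J1 (A i)"
    unfolding image_iff by metis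
  \<comment> \<open>The bivector is sought over these matrices only: they commute, whereas the whole
    stabilizer need not.\<close>
  define S where "S = A ` {1..CARD('n)}"
  have S: "S \<subseteq> stabilizer \<Lambda>" using A by (auto simp: S_def)
  have comm: "B ** C = C ** B" if "B \<in> S" "C \<in> S" for B C
    using that assms(3) A by (auto simp: S_def intro!: commute_if_sn_bracket_J1_eq_0)
  from assms(4) obtain x0 where "wedge_list (map (\<lambda>i. Y i x0) [1..<CARD('n) + 1]) \<noteq> 0" by blast
  also have "map (\<lambda>i. Y i x0) [1..<CARD('n) + 1] =
      map (\<lambda>i. one_vector (($) (x0 v* A i))) [1..<CARD('n) + 1]"
    using A by (intro map_cong) (auto simp: J1_eq)
  finally have "span ((\<lambda>i. x0 v* A i) ` set [1..<CARD('n) + 1]) = UNIV"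
    by (rule span_factors_of_nonzero_wedge) simp
  moreover have "set [1..<CARD('n) + 1] = {1..CARD('n)}" by auto
  ultimately have span: "span ((\<lambda>B. x0 v* B) ` S) = UNIV"
    unfolding S_def image_image by (simp only:)
  have "is_multivector 2 (\<Lambda> x0)"
    and quad: "\<And>K. homogeneous_quadratic (\<lambda>x. \<Lambda> x $ K)"
    using assms(1) by (auto simp: quadratic_poisson_def)
  from bivector_in_span_wedges[OF this(1) span]
  have "\<Lambda> x0 \<in> span {J1 B x0 \<and>\<^sub>e J1 C x0 | B C. B \<in> S \<and> C \<in> S}"
    by (rule rev_subsetD) (intro span_mono; auto simp: J1_eq)
  \<comment> \<open>Seen as an image under the linear map \<open>\<lambda>a. J a x0\<close>, the
    span lifts: the value of \<Lambda> at \<open>x0\<close> comes from some \<open>a\<close> in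
    \<open>wedge_square S\<close>.\<close>
  also have "{J1 B x0 \<and>\<^sub>e J1 C x0 | B C. B \<in> S \<and> C \<in> S} =
      (\<lambda>a. J a x0) ` {gl_ext B \<and>\<^sub>e gl_ext C | B C. B \<in> S \<and> C \<in> S}"
    by (force simp: J_gl_ext_wedge)
  finally obtain a where a: "a \<in> wedge_square S" "\<Lambda> x0 = J a x0"
    unfolding linear_span_image[OF linear_J] wedge_square_def by blast
  have "invariant_quadratic S \<Lambda>"
    using invariant_quadratic_stabilizer[OF quad] S unfolding invariant_quadratic_def by blast
  from invariant_quadratic_combination[OF this invariant_quadratic_J_wedge_square[OF comm a(1)],
      of 1 "- 1"]
  have "invariant_quadratic S (\<lambda>x. \<Lambda> x - J a x)" by simp
  \<comment> \<open>By the choice of \<open>a\<close> the invariant difference vanishes at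
    \<open>x0\<close>, hence everywhere.\<close>
  from invariant_quadratic_eq_0[OF this span] a(2) have "\<Lambda> = J a"
    by (simp add: fun_eq_iff)
  moreover have "classical_r_matrix a"
    using is_multivector_wedge_square[OF a(1)] gl_bracket_span_commuting[OF comm a(1) a(1)]
    by (simp add: classical_r_matrix_def)
  moreover have "a \<in> wedge_square (stabilizer \<Lambda>)"
    using a(1) S unfolding wedge_square_def by (rule_tac rev_subsetD) (auto intro!: span_mono)
  ultimately show ?thesis by blast
qed

end
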